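(* For a deformed $\mathbb D$-semi-classical orthogonal polynomial system, the recurrence matrix $K_n$ and the deformation matrix $B_n$ satisfy, for $n\ge0$, $$B_{n+1}\,\mathbb M_uK_n-\mathbb M_uK_n\,B_n=\mathbb D_uK_n-\tfrac14\Delta v^2\,B_{n+1}\,\mathbb D_uK_n\,B_n,$$ or equivalently $$K_n(\,\cdot\,;v_+)\left(1-\tfrac12\Delta vB_n\right)^{-1}\left(1+\tfrac12\Delta vB_n\right)=\left(1-\tfrac12\Delta vB_{n+1}\right)^{-1}\left(1+\tfrac12\Delta vB_{n+1}\right)K_n(\,\cdot\,;v_-).$$
   Context: **Lattices.** Let $\iota_\pm(x)$ be the two roots $y$ of a symmetric quadratic $\mathcal Ay^2+2\mathcal Bxy+\mathcal Ax^2+2\mathcal D(x+y)+\mathcal F=0$, $\mathcal A\ne0$; $y_\pm=\iota_\pm(x)$, $\Delta y=y_+-y_-$. The deformation variable $u$ has its own lattice of this kind (possibly a different conic), with $v_\pm=\iota_\pm(u)$, $\Delta v=v_+-v_-$ and operators $\mathbb D_uh=(h(v_+)-h(v_-))/\Delta v$, $\mathbb M_uh=\frac12(h(v_+)+h(v_-))$ (applied entrywise to matrices). **Weight and OPS.** $w(x;u)$ is a weight on a lattice support $G$ (with $\int_G\mathbb Dx\,h=\sum_s\Delta y(x_s)h(x_s)$). $p_n(x;u)=\gamma_n(u)x^n+\cdots$ are orthonormal, $\int_G\mathbb Dx\,w\,p_mp_n=\delta_{mn}$, $p_{-1}=0$; $q_n(x;u)=\int_G\mathbb Dy\,w(y;u)\frac{p_n(y;u)}{x-y}$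 for $n\ge0$. $a_{n+1}p_{n+1}=(x-b_n)p_n-a_np_{n-1}$ with $a_n=\gamma_{n-1}/\gamma_n$ ($n\ge1$); $a_0\neq0$ is arbitrary and $q_{-1}=1/(a_0\gamma_0)$; the $q_n$ satisfy the same recurrence. $Y_n=\begin{pmatrix} p_n & q_n/w \\ p_{n-1} & q_{n-1}/w \end{pmatrix}$ satisfies $Y_{n+1}=K_nY_n$ with recurrence matrix $K_n=\frac1{a_{n+1}}\begin{pmatrix} x-b_n & -a_n \\ a_{n+1} & 0 \end{pmatrix}$, and $\det Y_n=1/(a_nw)$. **Deformed $\mathbb D$-semi-classical weight:** $w(y_+;u)/w(y_-;u)=\frac{W+\Delta yV}{W-\Delta yV}(x;u)$ and $w(x;v_+)/w(x;v_-)=\frac{R+\Delta vS}{R-\Delta vS}(x;u)$ with $W,V,R,S$ polynomials in $x$, $R\pm\Delta vS\neq0$ for $x\in G$, $\gamma_n(v_\pm)\ne0$ for all $n$, and $\gamma_0(v_+)(R-\Delta vS)+\gamma_0(v_-)(R+\Delta vS)\ne0$. **Deformation matrix.** $B_n$ is the matrix, rational in $x$, for which $\mathbb D_uY_n=B_n\mathbb M_uY_n$, i.e. $B_n=(\mathbb D_uY_n)(\mathbb M_uY_n)^{-1}$ (where $\mathbb M_uY_n$ is invertible); $1$ denotes the $2\times2$ identity. *)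

theory Defs
  imports
    "HOL-Analysis.Analysis"
    "HOL-Computational_Algebra.Computational_Algebra"
    "HOL-Computational_Algebra.Field_as_Ring"
begin

record lattice =
  cA :: complex
  cB :: complex
  cD :: complex
  cF :: complex
  iota_plus :: "complex \<Rightarrow> complex"
  iota_minus :: "complex \<Rightarrow> complex"

text \<open>The factorisation expresses that the values of the two maps at a point are the two roots,
  counted with multiplicity. Which root is called plus may be chosen separately at every point.\<close>

definition is_lattice :: "lattice \<Rightarrow> bool" where
  "is_lattice L \<longleftrightarrow> cA L \<noteq> 0 \<and>
     (\<forall>x y. cA L * y^2 + 2 * cB L * x * y + cA L * x^2 + 2 * cD L * (x + y) + cF L
            = cA L * (y - iota_plus L x) * (y - iota_minus L x))"

definition gap :: "lattice \<Rightarrow> complex \<Rightarrow> complex" where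
  "gap L x = iota_plus L x - iota_minus L x"

text \<open>The support is traversed by points \<open>xs s\<close> with \<open>s\<close> in a finite, one-sided or two-sided
  index range; consecutive points are the two neighbours of a common intermediate point. (A finite support
  carries only finitely many orthonormal polynomials, so \<open>is_ops\<close> below is not satisfiable on it.)\<close>

definition lattice_support :: "lattice \<Rightarrow> (int \<Rightarrow> complex) \<Rightarrow> int set \<Rightarrow> bool" where
  "lattice_support L xs S \<longleftrightarrow>
     ((\<exists>N\<ge>0. S = {0..N}) \<or> S = {0..} \<or> S = UNIV) \<and>
     (\<forall>s. s \<in> S \<and> s + 1 \<in> S \<longrightarrow> iota_plus L (xs s) = iota_minus L (xs (s + 1)))"

definition dint :: "lattice \<Rightarrow> (int \<Rightarrow> complex) \<Rightarrow> int set \<Rightarrow> (complex \<Rightarrow> complex) \<Rightarrow> complex" where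
  "dint L xs S h = (\<Sum>\<^sub>\<infinity>s\<in>S. gap L (xs s) * h (xs s))"

definition dintegrable ::
  "lattice \<Rightarrow> (int \<Rightarrow> complex) \<Rightarrow> int set \<Rightarrow> (complex \<Rightarrow> complex) \<Rightarrow> bool" where
  "dintegrable L xs S h \<longleftrightarrow> (\<lambda>s. gap L (xs s) * h (xs s)) summable_on S"


definition mscale :: "'a::times \<Rightarrow> 'a^2^2 \<Rightarrow> 'a^2^2" where
  "mscale c A = (\<chi> i j. c * A $ i $ j)"

text \<open>The divided difference and the mean act entrywise. The entries may be complex numbers or
  rational functions; \<open>e\<close> embeds the complex scalars into the type of the entries.\<close>

definition DD :: "(complex \<Rightarrow> 'a) \<Rightarrow> lattice \<Rightarrow> (complex \<Rightarrow> 'a::field^2^2) \<Rightarrow> complex \<Rightarrow> 'a^2^2" where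
  "DD e L h u =
     (\<chi> i j. (h (iota_plus L u) $ i $ j - h (iota_minus L u) $ i $ j) / e (gap L u))"

definition MM :: "lattice \<Rightarrow> (complex \<Rightarrow> 'a::field^2^2) \<Rightarrow> complex \<Rightarrow> 'a^2^2" where
  "MM L h u = (\<chi> i j. (h (iota_plus L u) $ i $ j + h (iota_minus L u) $ i $ j) / 2)"

type_synonym ratfun = "complex poly fract"

definition rconst :: "complex \<Rightarrow> ratfun" where
  "rconst c = to_fract [:c:]"

text \<open>Evaluation uses the reduced fraction; at a pole the value is the conventional 0.\<close>

definition rat_eval :: "ratfun \<Rightarrow> complex \<Rightarrow> complex" where
  "rat_eval r x = poly (fst (quot_of_fract r)) x / poly (snd (quot_of_fract r)) x"

definition mat_eval :: "ratfun^2^2 \<Rightarrow> complex \<Rightarrow> complex^2^2" where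
  "mat_eval B x = (\<chi> i j. rat_eval (B $ i $ j) x)"


text \<open>Throughout, \<open>w x t\<close> is the weight at the point \<open>x\<close> for the parameter value \<open>t\<close>, and \<open>p n t\<close> is
  the polynomial of index \<open>n\<close> for the parameter value \<open>t\<close>.\<close>

definition leadc :: "(nat \<Rightarrow> complex \<Rightarrow> complex poly) \<Rightarrow> nat \<Rightarrow> complex \<Rightarrow> complex" where
  "leadc p n t = coeff (p n t) n"

definition acoeff ::
  "(nat \<Rightarrow> complex \<Rightarrow> complex poly) \<Rightarrow> (complex \<Rightarrow> complex) \<Rightarrow> nat \<Rightarrow> complex \<Rightarrow> complex" where
  "acoeff p a0 n t = (case n of 0 \<Rightarrow> a0 t | Suc m \<Rightarrow> leadc p m t / leadc p (Suc m) t)"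

definition pprev :: "(nat \<Rightarrow> complex \<Rightarrow> complex poly) \<Rightarrow> nat \<Rightarrow> complex \<Rightarrow> complex poly" where
  "pprev p n t = (case n of 0 \<Rightarrow> 0 | Suc m \<Rightarrow> p m t)"

definition qfun ::
  "lattice \<Rightarrow> (int \<Rightarrow> complex) \<Rightarrow> int set \<Rightarrow> (complex \<Rightarrow> complex \<Rightarrow> complex) \<Rightarrow>
   (nat \<Rightarrow> complex \<Rightarrow> complex poly) \<Rightarrow> nat \<Rightarrow> complex \<Rightarrow> complex \<Rightarrow> complex" where
  "qfun L xs S w p n t x = dint L xs S (\<lambda>y. w y t * (poly (p n t) y / (x - y)))"

definition qprev ::
  "lattice \<Rightarrow> (int \<Rightarrow> complex) \<Rightarrow> int set \<Rightarrow> (complex \<Rightarrow> complex \<Rightarrow> complex) \<Rightarrow>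
   (nat \<Rightarrow> complex \<Rightarrow> complex poly) \<Rightarrow> (complex \<Rightarrow> complex) \<Rightarrow> nat \<Rightarrow> complex \<Rightarrow> complex \<Rightarrow> complex" where
  "qprev L xs S w p a0 n t x =
     (case n of 0 \<Rightarrow> 1 / (a0 t * leadc p 0 t) | Suc m \<Rightarrow> qfun L xs S w p m t x)"

text \<open>The three-term recurrence determines the coefficients \<open>b n t\<close>.\<close>

definition is_ops ::
  "lattice \<Rightarrow> (int \<Rightarrow> complex) \<Rightarrow> int set \<Rightarrow> (complex \<Rightarrow> complex \<Rightarrow> complex) \<Rightarrow>
   (nat \<Rightarrow> complex \<Rightarrow> complex poly) \<Rightarrow> (complex \<Rightarrow> complex) \<Rightarrow> (nat \<Rightarrow> complex \<Rightarrow> complex) \<Rightarrow>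
   complex \<Rightarrow> bool" where
  "is_ops L xs S w p a0 b t \<longleftrightarrow>
     (\<forall>k::nat. dintegrable L xs S (\<lambda>x. w x t * x ^ k)) \<and>
     (\<forall>n. degree (p n t) \<le> n \<and> leadc p n t \<noteq> 0) \<and>
     (\<forall>m n. dint L xs S (\<lambda>x. w x t * poly (p m t) x * poly (p n t) x) = (if m = n then 1 else 0)) \<and>
     a0 t \<noteq> 0 \<and>
     (\<forall>n. smult (acoeff p a0 (Suc n) t) (p (Suc n) t)
          = [:- b n t, 1:] * p n t - smult (acoeff p a0 n t) (pprev p n t))"

definition Ymat ::
  "lattice \<Rightarrow> (int \<Rightarrow> complex) \<Rightarrow> int set \<Rightarrow> (complex \<Rightarrow> complex \<Rightarrow> complex) \<Rightarrow>
   (nat \<Rightarrow> complex \<Rightarrow> complex poly) \<Rightarrow> (complex \<Rightarrow> complex) \<Rightarrow> nat \<Rightarrow> complex \<Rightarrow> complex \<Rightarrow>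
   complex^2^2" where
  "Ymat L xs S w p a0 n x t = vector
     [vector [poly (p n t) x, qfun L xs S w p n t x / w x t],
      vector [poly (pprev p n t) x, qprev L xs S w p a0 n t x / w x t]]"

definition Kmat ::
  "(nat \<Rightarrow> complex \<Rightarrow> complex poly) \<Rightarrow> (complex \<Rightarrow> complex) \<Rightarrow> (nat \<Rightarrow> complex \<Rightarrow> complex) \<Rightarrow>
   nat \<Rightarrow> complex \<Rightarrow> ratfun^2^2" where
  "Kmat p a0 b n t = mscale (rconst (1 / acoeff p a0 (Suc n) t)) (vector
     [vector [to_fract [:- b n t, 1:], - rconst (acoeff p a0 n t)],
      vector [rconst (acoeff p a0 (Suc n) t), 0]])"


text \<open>The set \<open>X\<close> is the set of points at which the weight is defined and nonzero; it contains
  the support and the points off the support at which the associated functions are considered.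
  A quotient of weights is prescribed whenever both weights are taken at points of \<open>X\<close>, and its
  right-hand side is required to be well defined there.\<close>

definition semi_classical ::
  "lattice \<Rightarrow> complex set \<Rightarrow> (complex \<Rightarrow> complex \<Rightarrow> complex) \<Rightarrow>
   (complex \<Rightarrow> complex poly) \<Rightarrow> (complex \<Rightarrow> complex poly) \<Rightarrow> complex \<Rightarrow> bool" where
  "semi_classical L X w W V t \<longleftrightarrow>
     (\<forall>x. iota_plus L x \<in> X \<and> iota_minus L x \<in> X \<longrightarrow>
        poly (W t) x - gap L x * poly (V t) x \<noteq> 0 \<and>
        w (iota_plus L x) t / w (iota_minus L x) t
        = (poly (W t) x + gap L x * poly (V t) x) / (poly (W t) x - gap L x * poly (V t) x))"

definition deformed ::
  "lattice \<Rightarrow> complex set \<Rightarrow> (complex \<Rightarrow> complex \<Rightarrow> complex) \<Rightarrow>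
   (complex \<Rightarrow> complex poly) \<Rightarrow> (complex \<Rightarrow> complex poly) \<Rightarrow> complex \<Rightarrow> bool" where
  "deformed Lu X w R S u \<longleftrightarrow>
     (\<forall>x\<in>X. poly (R u) x - gap Lu u * poly (S u) x \<noteq> 0 \<and>
        w x (iota_plus Lu u) / w x (iota_minus Lu u)
        = (poly (R u) x + gap Lu u * poly (S u) x) / (poly (R u) x - gap Lu u * poly (S u) x))"

text \<open>\<open>L\<close>, \<open>Lu\<close> are the lattices of the spectral and of the deformation variable, \<open>I\<close> is the index
  range of the support, and \<open>T\<close> is the set of parameter values for which the system is given.\<close>

definition deformed_semi_classical_ops ::
  "lattice \<Rightarrow> (int \<Rightarrow> complex) \<Rightarrow> int set \<Rightarrow> complex set \<Rightarrow> lattice \<Rightarrow> complex set \<Rightarrow> complex \<Rightarrow>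
   (complex \<Rightarrow> complex \<Rightarrow> complex) \<Rightarrow>
   (complex \<Rightarrow> complex poly) \<Rightarrow> (complex \<Rightarrow> complex poly) \<Rightarrow>
   (complex \<Rightarrow> complex poly) \<Rightarrow> (complex \<Rightarrow> complex poly) \<Rightarrow>
   (nat \<Rightarrow> complex \<Rightarrow> complex poly) \<Rightarrow> (complex \<Rightarrow> complex) \<Rightarrow> (nat \<Rightarrow> complex \<Rightarrow> complex) \<Rightarrow> bool" where
  "deformed_semi_classical_ops L xs I X Lu T u w W V R S p a0 b \<longleftrightarrow>
     is_lattice L \<and> is_lattice Lu \<and> lattice_support L xs I \<and> xs ` I \<subseteq> X \<and>
     iota_plus Lu u \<in> T \<and> iota_minus Lu u \<in> T \<and> gap Lu u \<noteq> 0 \<and>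
     (\<forall>t\<in>T. (\<forall>x\<in>X. w x t \<noteq> 0) \<and> is_ops L xs I w p a0 b t \<and> semi_classical L X w W V t \<and>
        (\<forall>x \<in> X - xs ` I. dintegrable L xs I (\<lambda>y. w y t * (1 / (x - y))))) \<and>
     deformed Lu X w R S u \<and>
     (\<forall>x \<in> xs ` I. poly (R u) x + gap Lu u * poly (S u) x \<noteq> 0 \<and>
                   poly (R u) x - gap Lu u * poly (S u) x \<noteq> 0) \<and>
     smult (leadc p 0 (iota_plus Lu u)) (R u - smult (gap Lu u) (S u)) +
     smult (leadc p 0 (iota_minus Lu u)) (R u + smult (gap Lu u) (S u)) \<noteq> 0"

text \<open>A matrix of rational functions is the deformation matrix for \<open>Y\<close> if the defining relation
  holds on \<open>Z\<close>, finitely many points (such as poles) excepted. For \<open>Y\<close> invertible at both shifted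
  parameters the relation forces the mean of \<open>Y\<close> to be invertible, so on an infinite \<open>Z\<close> there is
  at most one such matrix and it is the quotient of the divided difference by the mean.\<close>

definition is_deformation_matrix ::
  "lattice \<Rightarrow> complex set \<Rightarrow> complex \<Rightarrow> (complex \<Rightarrow> complex \<Rightarrow> complex^2^2) \<Rightarrow> ratfun^2^2 \<Rightarrow> bool" where
  "is_deformation_matrix Lu Z u Y B \<longleftrightarrow>
     finite {x \<in> Z. DD id Lu (Y x) u \<noteq> mat_eval B x ** MM Lu (Y x) u}"

end

theory Submission
  imports Defs
begin

text \<open>Put \<open>M\<^sub>n = \<M>\<^sub>u Y\<^sub>n\<close> and \<open>h = \<Delta>v / 2\<close>. The defining relation of \<open>B\<^sub>n\<close> says
  \<open>(1 - h B\<^sub>n) M\<^sub>n = Y\<^sub>n(v\<^sub>-)\<close> and \<open>(1 + h B\<^sub>n) M\<^sub>n = Y\<^sub>n(v\<^sub>+)\<close>. With \<open>Y\<^sub>n\<^sub>+\<^sub>1 = K\<^sub>n Y\<^sub>n\<close> at both shifted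
  parameters, \<open>(1 - h B\<^sub>n\<^sub>+\<^sub>1) K\<^sub>n(v\<^sub>+) (1 + h B\<^sub>n)\<close> and \<open>(1 + h B\<^sub>n\<^sub>+\<^sub>1) K\<^sub>n(v\<^sub>-) (1 - h B\<^sub>n)\<close> agree after
  multiplication by \<open>M\<^sub>n\<close>, which is invertible because \<open>Y\<^sub>n(v\<^sub>-)\<close> is. They agree at infinitely many
  points, hence as rational functions; both forms of the compatibility relation are
  rearrangements of this identity.\<close>

section \<open>Evaluation of rational functions\<close>

text \<open>Regularity at a point means absence of a pole there. It is the side condition under
  which \<open>rat_eval\<close> is compatible with the field operations: at 0 both 1/x and 1 - 1/x
  get the conventional value 0, although their sum is 1.\<close>

definition regular_at :: "ratfun \<Rightarrow> complex \<Rightarrow> bool" where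
  "regular_at r x \<longleftrightarrow> poly (snd (quot_of_fract r)) x \<noteq> 0"

lemma ratfun_mult_denom: "r * to_fract (snd (quot_of_fract r)) = to_fract (fst (quot_of_fract r))"
  for r :: ratfun
proof -
  have "r = to_fract (fst (quot_of_fract r)) / to_fract (snd (quot_of_fract r))"
    by (metis Fract_conv_to_fract quot_to_fract_def quot_to_fract_quot_of_fract case_prod_beta')
  then show ?thesis
    by (metis to_fract_eq_0_iff nonzero_eq_divide_eq snd_quot_of_fract_nonzero)
qed

text \<open>The reduced denominator is coprime to the reduced numerator, so it divides every other
  denominator \<open>d\<close> of the same fraction. Hence any representation whose denominator does
  not vanish at \<open>x\<close> computes the value, and sums and products need not be reduced
  first.\<close>

lemma regular_at_fraction:
  assumes "r * to_fract d = to_fract a" and "poly d x \<noteq> 0"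
  shows "regular_at r x" and "rat_eval r x = poly a x / poly d x"
proof -
  define n q where "n = fst (quot_of_fract r)" and "q = snd (quot_of_fract r)"
  have nq: "r * to_fract q = to_fract n"
    unfolding n_def q_def by (rule ratfun_mult_denom)
  have "to_fract (n * d) = to_fract (a * q)"
    by (simp add: ac_simps flip: nq assms(1))
  then have eq: "n * d = a * q" by (simp only: to_fract_eq_iff)
  have "coprime q n"
    unfolding n_def q_def by (simp add: coprime_quot_of_fract coprime_commute)
  with eq have "q dvd d"
    by (metis coprime_dvd_mult_right_iff dvd_triv_right)
  with assms(2) have q: "poly q x \<noteq> 0" by (auto elim!: dvdE)
  then show "regular_at r x" by (simp add: regular_at_def q_def)
  have "poly n x * poly d x = poly a x * poly q x"
    using eq by (metis poly_mult)
  then show "rat_eval r x = poly a x / poly d x"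
    using q assms(2) unfolding rat_eval_def n_def[symmetric] q_def[symmetric]
    by (simp add: field_simps)
qed

lemma regular_at_to_fract [simp]: "regular_at (to_fract a) x"
  and rat_eval_to_fract [simp]: "rat_eval (to_fract a) x = poly a x"
  by (simp_all add: regular_at_def rat_eval_def)

lemma regular_at_rconst [simp]: "regular_at (rconst c) x"
  and rat_eval_rconst [simp]: "rat_eval (rconst c) x = c"
  by (simp_all add: rconst_def)

lemma rconst_0: "rconst 0 = 0" and rconst_1: "rconst 1 = 1"
  by (simp_all add: rconst_def flip: one_pCons)

lemma rconst_eq_0_iff [simp]: "rconst c = 0 \<longleftrightarrow> c = 0"
  by (simp add: rconst_def)

lemma rconst_add: "rconst (c + d) = rconst c + rconst d"
  by (simp add: rconst_def flip: to_fract_add)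

lemma rconst_mult: "rconst (c * d) = rconst c * rconst d"
  by (simp add: rconst_def flip: to_fract_mult)

lemma rconst_2: "rconst 2 = 2"
  using rconst_add[of 1 1] by (simp add: rconst_1)

lemma rconst_half: "rconst (c / 2) = rconst c / 2"
  using rconst_mult[of "c / 2" 2] rconst_eq_0_iff[of 2] by (simp add: rconst_2 field_simps)

lemma regular_at_0 [simp]: "regular_at 0 x" and rat_eval_0 [simp]: "rat_eval 0 x = 0"
  and regular_at_1 [simp]: "regular_at 1 x" and rat_eval_1 [simp]: "rat_eval 1 x = 1"
  using regular_at_rconst[of 0 x] rat_eval_rconst[of 0 x]
    regular_at_rconst[of 1 x] rat_eval_rconst[of 1 x] by (simp_all add: rconst_0 rconst_1)

context
  fixes r s :: ratfun and x :: complex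
  assumes regular: "regular_at r x" "regular_at s x"
begin

private lemma denoms: "poly (snd (quot_of_fract r) * snd (quot_of_fract s)) x \<noteq> 0"
  using regular by (simp add: regular_at_def)

lemma regular_at_add: "regular_at (r + s) x"
  and rat_eval_add: "rat_eval (r + s) x = rat_eval r x + rat_eval s x"
proof -
  have "(r + s) * to_fract (snd (quot_of_fract r) * snd (quot_of_fract s)) =
    to_fract (fst (quot_of_fract r) * snd (quot_of_fract s)
      + snd (quot_of_fract r) * fst (quot_of_fract s))"
    unfolding to_fract_mult to_fract_add ratfun_mult_denom[symmetric] by (simp add: algebra_simps)
  note * = regular_at_fraction[OF this denoms]
  show "regular_at (r + s) x" by (rule *)
  show "rat_eval (r + s) x = rat_eval r x + rat_eval s x"
    using regular unfolding *(2) rat_eval_def[of r] rat_eval_def[of s] regular_at_def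
    by (simp add: add_frac_eq mult.commute)
qed

lemma regular_at_mult: "regular_at (r * s) x"
  and rat_eval_mult: "rat_eval (r * s) x = rat_eval r x * rat_eval s x"
proof -
  have "(r * s) * to_fract (snd (quot_of_fract r) * snd (quot_of_fract s)) =
    to_fract (fst (quot_of_fract r) * fst (quot_of_fract s))"
    unfolding to_fract_mult ratfun_mult_denom[symmetric] by (simp add: algebra_simps)
  note * = regular_at_fraction[OF this denoms]
  show "regular_at (r * s) x" by (rule *)
  show "rat_eval (r * s) x = rat_eval r x * rat_eval s x"
    by (simp add: * rat_eval_def[of r] rat_eval_def[of s])
qed

end

lemma regular_at_uminus:
  assumes "regular_at r x"
  shows "regular_at (- r) x" and "rat_eval (- r) x = - rat_eval r x"
proof -
  have "rconst (- 1) = - 1"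
    using rconst_add[of "- 1" 1] by (simp add: rconst_0 rconst_1 eq_neg_iff_add_eq_0)
  then have "- r = rconst (- 1) * r" by simp
  then show "regular_at (- r) x" "rat_eval (- r) x = - rat_eval r x"
    using assms by (simp_all add: regular_at_mult rat_eval_mult)
qed

lemma regular_at_diff:
  assumes "regular_at r x" "regular_at s x"
  shows "regular_at (r - s) x" and "rat_eval (r - s) x = rat_eval r x - rat_eval s x"
  using regular_at_add[of r x "- s"] rat_eval_add[of r x "- s"] regular_at_uminus[of s x] assms
  by simp_all

lemma finite_not_regular_at: "finite {x. \<not> regular_at r x}"
  unfolding regular_at_def by (simp add: poly_roots_finite)

text \<open>At a regular point the value 0 comes from a root of the numerator, and a polynomial with
  infinitely many roots is zero.\<close>

lemma ratfun_eq_0: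
  assumes "infinite Z" and "\<And>x. x \<in> Z \<Longrightarrow> regular_at r x \<and> rat_eval r x = 0"
  shows "r = 0"
proof -
  have "poly (fst (quot_of_fract r)) x = 0" if "x \<in> Z" for x
    using assms(2)[OF that] by (auto simp: rat_eval_def regular_at_def)
  then have "Z \<subseteq> {x. poly (fst (quot_of_fract r)) x = 0}" by blast
  with assms(1) have "fst (quot_of_fract r) = 0"
    using poly_roots_finite finite_subset by blast
  then show ?thesis
    by (metis to_fract_eq_0_iff ratfun_mult_denom mult_eq_0_iff snd_quot_of_fract_nonzero)
qed

section \<open>Matrices of rational functions\<close>

definition mat_regular_at :: "ratfun^2^2 \<Rightarrow> complex \<Rightarrow> bool" where
  "mat_regular_at A x \<longleftrightarrow> (\<forall>i j. regular_at (A $ i $ j) x)"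

lemmas matrix_2_simps = vec_eq_iff forall_2 sum_2 matrix_matrix_mult_def mat_def

lemma finite_not_mat_regular_at: "finite {x. \<not> mat_regular_at A x}"
proof -
  have "{x. \<not> mat_regular_at A x} = (\<Union>i j. {x. \<not> regular_at (A $ i $ j) x})"
    by (auto simp: mat_regular_at_def)
  then show ?thesis by (simp add: finite_not_regular_at)
qed

lemma mat_regular_at_one [simp]: "mat_regular_at (mat 1) x"
  and mat_eval_one [simp]: "mat_eval (mat 1) x = mat 1"
  by (simp_all add: mat_regular_at_def mat_eval_def matrix_2_simps)

lemma mat_regular_at_mscale:
  assumes "mat_regular_at A x"
  shows "mat_regular_at (mscale (rconst c) A) x"
    and "mat_eval (mscale (rconst c) A) x = mscale c (mat_eval A x)"
  using assms
  by (simp_all add: mat_regular_at_def mat_eval_def mscale_def vec_eq_iff regular_at_mult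
      rat_eval_mult)

lemma mat_regular_at_binary:
  assumes "mat_regular_at A x" "mat_regular_at B x"
  shows "mat_regular_at (A + B) x" "mat_eval (A + B) x = mat_eval A x + mat_eval B x"
    and "mat_regular_at (A - B) x" "mat_eval (A - B) x = mat_eval A x - mat_eval B x"
    and "mat_regular_at (A ** B) x" "mat_eval (A ** B) x = mat_eval A x ** mat_eval B x"
  using assms
  by (simp_all add: mat_regular_at_def mat_eval_def matrix_2_simps regular_at_add rat_eval_add
      regular_at_diff regular_at_mult rat_eval_mult)

lemma det_regular_at:
  assumes "mat_regular_at A x"
  shows "regular_at (det A) x" and "rat_eval (det A) x = det (mat_eval A x)"
  using assms
  by (simp_all add: mat_regular_at_def mat_eval_def det_2 regular_at_diff regular_at_mult
      rat_eval_mult)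

text \<open>This is the passage from pointwise identities in \<open>x\<close> to identities over the
  field of rational functions.\<close>

lemma ratfun_matrix_eqI:
  assumes "infinite Z"
    and "\<And>x. x \<in> Z \<Longrightarrow> mat_regular_at A x \<and> mat_regular_at B x \<and> mat_eval A x = mat_eval B x"
  shows "A = B"
proof -
  have "A $ i $ j - B $ i $ j = 0" for i j
  proof (rule ratfun_eq_0[OF assms(1)])
    fix x assume "x \<in> Z"
    from assms(2)[OF this]
    show "regular_at (A $ i $ j - B $ i $ j) x \<and> rat_eval (A $ i $ j - B $ i $ j) x = 0"
      by (simp add: mat_regular_at_def mat_eval_def vec_eq_iff regular_at_diff)
  qed
  then show ?thesis by (simp add: vec_eq_iff)
qed

section \<open>Cayley transforms\<close>

lemma cayley_factors_commute:
  fixes B :: "'a::field^2^2"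
  shows "(mat 1 - mscale h B) ** (mat 1 + mscale h B) = (mat 1 + mscale h B) ** (mat 1 - mscale h B)"
  by (simp add: matrix_2_simps mscale_def algebra_simps)

text \<open>With \<open>M\<close> and \<open>D\<close> the mean and divided difference of the
  recurrence matrix, \<open>M + mscale h D\<close> and \<open>M - mscale h D\<close> are its two
  shifted values. The two triple products differ only by the sign of \<open>h\<close>, so in their
  difference the even powers of \<open>h\<close> cancel and the odd ones double; dividing by
  \<open>2 * h\<close> leaves the compatibility relation.\<close>

lemma cayley_compatibility_iff:
  fixes B B' M D :: "'a::field^2^2"
  assumes "h \<noteq> 0" and "(2::'a) \<noteq> 0"
  shows "(mat 1 - mscale h B') ** (M + mscale h D) ** (mat 1 + mscale h B)
       = (mat 1 + mscale h B') ** (M - mscale h D) ** (mat 1 - mscale h B)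
     \<longleftrightarrow> B' ** M - M ** B = D - mscale (h^2) (B' ** D ** B)" (is "?l = ?r \<longleftrightarrow> ?s = ?t")
proof -
  have "?l - ?r = mscale (2 * h) (?t - ?s)"
    by (simp add: matrix_2_simps mscale_def algebra_simps power2_eq_square)
  moreover have "mscale (2 * h) A = 0 \<longleftrightarrow> A = 0" for A :: "'a^2^2"
    using assms by (auto simp: mscale_def vec_eq_iff)
  ultimately show ?thesis by (metis eq_iff_diff_eq_0)
qed

lemma matrix_inv_mult:
  fixes A :: "'a::field^'n^'n"
  assumes "invertible A"
  shows "matrix_inv A ** A = mat 1" and "A ** matrix_inv A = mat 1"
  using someI_ex[OF assms[unfolded invertible_def]] by (simp_all add: matrix_inv_def)

text \<open>Multiplying the last assumption by the inverse of \<open>A'\<close> on the left and of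
  \<open>A\<close> on the right gives the claim up to the order of \<open>C\<close> and the inverse
  of \<open>A\<close>, which commute because \<open>A\<close> and \<open>C\<close> do.\<close>

lemma conjugate_by_inverses:
  fixes A A' C C' K K' :: "'a::field^'n^'n"
  assumes "invertible A" and "invertible A'" and "A ** C = C ** A"
    and "A' ** K ** C = C' ** K' ** A"
  shows "K ** matrix_inv A ** C = matrix_inv A' ** C' ** K'"
proof -
  have "matrix_inv A ** C = matrix_inv A ** (C ** A) ** matrix_inv A"
    using assms(1) by (simp add: matrix_inv_mult flip: matrix_mul_assoc)
  also have "\<dots> = C ** matrix_inv A"
    using assms(1) by (simp add: matrix_inv_mult matrix_mul_assoc flip: assms(3))
  finally have "K ** matrix_inv A ** C = matrix_inv A' ** (A' ** K ** C) ** matrix_inv A"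
    using assms(2) by (simp add: matrix_inv_mult matrix_mul_assoc) (simp flip: matrix_mul_assoc)
  also have "\<dots> = matrix_inv A' ** C' ** K'"
    using assms(1) unfolding assms(4) by (simp add: matrix_inv_mult flip: matrix_mul_assoc)
  finally show ?thesis .
qed

text \<open>The mean plus or minus half the gap times the divided difference is the value at the
  plus or minus shift; the defining relation then replaces the divided difference by
  \<open>B\<close> times the mean.\<close>

lemma shifted_values_from_mean:
  assumes "DD id Lu Y u = B ** MM Lu Y u" and "gap Lu u \<noteq> 0"
  shows "(mat 1 - mscale (gap Lu u / 2) B) ** MM Lu Y u = Y (iota_minus Lu u)"
    and "(mat 1 + mscale (gap Lu u / 2) B) ** MM Lu Y u = Y (iota_plus Lu u)"
proof -
  have "(mat 1 - mscale c B) ** M = M - mscale c (B ** M)"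
    and "(mat 1 + mscale c B) ** M = M + mscale c (B ** M)" for c and M :: "complex^2^2"
    by (simp_all add: matrix_2_simps mscale_def algebra_simps)
  note * = this[of "gap Lu u / 2" "MM Lu Y u", folded assms(1)]
  show "(mat 1 - mscale (gap Lu u / 2) B) ** MM Lu Y u = Y (iota_minus Lu u)"
    and "(mat 1 + mscale (gap Lu u / 2) B) ** MM Lu Y u = Y (iota_plus Lu u)"
    unfolding * using assms(2) by (simp_all add: vec_eq_iff mscale_def DD_def MM_def field_simps)
qed

section \<open>The recurrence in the index\<close>

lemma has_sum_dint:
  assumes "dintegrable L xs S h"
  shows "((\<lambda>s. gap L (xs s) * h (xs s)) has_sum dint L xs S h) S"
  using assms unfolding dintegrable_def dint_def by (rule has_sum_infsum)

lemma summable_on_finite_sum: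
  fixes f :: "'k \<Rightarrow> 'a \<Rightarrow> complex"
  assumes "\<And>k. k \<in> K \<Longrightarrow> f k summable_on A"
  shows "(\<lambda>s. \<Sum>k\<in>K. f k s) summable_on A"
  using assms by (induction K rule: infinite_finite_induct) (auto intro: summable_on_add)

lemma dintegrable_poly:
  assumes "\<And>k::nat. dintegrable L xs S (\<lambda>x. w x * x ^ k)"
  shows "dintegrable L xs S (\<lambda>x. w x * poly f x)"
proof -
  have "(\<lambda>s. \<Sum>k\<le>degree f. coeff f k * (gap L (xs s) * (w (xs s) * xs s ^ k))) summable_on S"
    using assms unfolding dintegrable_def
    by (intro summable_on_finite_sum summable_on_cmult_right) auto
  then show ?thesis
    unfolding dintegrable_def poly_altdef by (simp add: sum_distrib_left mult_ac)
qed

text \<open>Dividing \<open>f\<close> by the linear factor with root \<open>x\<close> gives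
  f(y)/(x-y) = f(x)/(x-y) - g(y), where \<open>g\<close> is the polynomial quotient. The first term
  is a multiple of the bare Cauchy kernel and the second needs only the moments.\<close>

lemma dintegrable_cauchy_kernel:
  assumes "\<And>k::nat. dintegrable L xs S (\<lambda>x. w x * x ^ k)"
    and "dintegrable L xs S (\<lambda>y. w y * (1 / (x - y)))" and "x \<notin> xs ` S"
  shows "dintegrable L xs S (\<lambda>y. w y * (poly f y / (x - y)))"
proof -
  define g where "g = synthetic_div f x"
  have "poly f y = poly f x + (y - x) * poly g y" for y
    using arg_cong[OF synthetic_div_correct'[of x f], of "\<lambda>p. poly p y"]
    by (simp add: g_def algebra_simps)
  then have split: "poly f x * (gap L (xs s) * (w (xs s) * (1 / (x - xs s))))
      + (-1) * (gap L (xs s) * (w (xs s) * poly g (xs s)))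
      = gap L (xs s) * (w (xs s) * (poly f (xs s) / (x - xs s)))" if "s \<in> S" for s
  proof -
    have "x - xs s \<noteq> 0" using assms(3) that by auto
    then show ?thesis
      unfolding \<open>\<And>y. poly f y = poly f x + (y - x) * poly g y\<close>[of "xs s"]
      by (simp add: field_simps)
  qed
  have "(\<lambda>s. poly f x * (gap L (xs s) * (w (xs s) * (1 / (x - xs s))))
      + (-1) * (gap L (xs s) * (w (xs s) * poly g (xs s)))) summable_on S"
    using assms(2) dintegrable_poly[OF assms(1), of g] unfolding dintegrable_def
    by (intro summable_on_add summable_on_cmult_right)
  then show ?thesis
    unfolding dintegrable_def using split by (simp cong: summable_on_cong)
qed

section \<open>Recurrences for the polynomials and associated functions at a point off the
  support\<close>

context
  fixes L :: lattice and xs :: "int \<Rightarrow> complex" and I :: "int set"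
    and w :: "complex \<Rightarrow> complex \<Rightarrow> complex" and p :: "nat \<Rightarrow> complex \<Rightarrow> complex poly"
    and a0 :: "complex \<Rightarrow> complex" and b :: "nat \<Rightarrow> complex \<Rightarrow> complex" and t x :: complex
  assumes ops: "is_ops L xs I w p a0 b t"
    and kernel: "dintegrable L xs I (\<lambda>y. w y t * (1 / (x - y)))"
    and off_support: "x \<notin> xs ` I" and weight: "w x t \<noteq> 0"
begin

lemma acoeff_nonzero: "acoeff p a0 n t \<noteq> 0"
  using ops by (auto simp: acoeff_def is_ops_def split: nat.split)

lemma leadc_nonzero: "leadc p n t \<noteq> 0"
  using ops by (auto simp: is_ops_def)

lemma poly_recurrence:
  "acoeff p a0 (Suc n) t * poly (p (Suc n) t) y =
     (y - b n t) * poly (p n t) y - acoeff p a0 n t * poly (pprev p n t) y"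
proof -
  have "smult (acoeff p a0 (Suc n) t) (p (Suc n) t)
          = [:- b n t, 1:] * p n t - smult (acoeff p a0 n t) (pprev p n t)"
    using ops by (simp add: is_ops_def)
  from arg_cong[OF this, of "\<lambda>f. poly f y"] show ?thesis
    by (simp add: algebra_simps)
qed

lemma poly_p0: "poly (p 0 t) y = leadc p 0 t"
proof -
  have "degree (p n t) \<le> n" for n using ops unfolding is_ops_def by blast
  from this[of 0] show ?thesis by (auto simp: leadc_def elim!: degree_eq_zeroE)
qed

text \<open>Since \<open>p 0 t\<close> is the constant \<open>leadc p 0 t\<close>, this is
  orthonormality against it, rescaled. The nonzero value at \<open>n = 0\<close> is the boundary
  term in the recurrence of the associated functions.\<close>

lemma dint_poly: "dint L xs I (\<lambda>y. w y t * poly (p n t) y) = (if n = 0 then 1 / leadc p 0 t else 0)"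
proof -
  have "leadc p 0 t * dint L xs I (\<lambda>y. w y t * poly (p n t) y)
      = dint L xs I (\<lambda>y. w y t * poly (p 0 t) y * poly (p n t) y)"
    by (simp add: dint_def poly_p0 infsum_cmult_right' mult_ac flip: infsum_cmult_right')
  also have "\<dots> = (if 0 = n then 1 else 0)" using ops unfolding is_ops_def by blast
  finally show ?thesis using leadc_nonzero[of 0] by (auto simp: field_simps)
qed

text \<open>The recurrence of the polynomials is integrated against w(y)/(x-y), with y - b split as
  (x - b) - (x - y). The second part cancels the kernel and leaves the integral of w times
  \<open>p n t\<close>. This vanishes by orthogonality for n > 0, and for n = 0 it equals a_0
  q_{-1}, which is why q_{-1} is normalised as 1/(a_0 gamma_0).\<close>

lemma q_recurrence:
  "acoeff p a0 (Suc n) t * qfun L xs I w p (Suc n) t x =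
     (x - b n t) * qfun L xs I w p n t x - acoeff p a0 n t * qprev L xs I w p a0 n t x"
proof -
  have kernel_identity: "((y - c) * P - a * Q) / (x - y) = (x - c) * (P / (x - y)) - P - a * (Q / (x - y))"
    if "x - y \<noteq> 0" for y c P a Q :: complex
  proof -
    have "((x - d - c) * P - a * Q) / d = (x - c) * (P / d) - P - a * (Q / d)" if "d \<noteq> 0" for d
      using that by (simp add: field_simps)
    from this[OF that] show ?thesis by simp
  qed
  define G where "G f s = gap L (xs s) * (w (xs s) t * (poly f (xs s) / (x - xs s)))" for f s
  define H where "H s = gap L (xs s) * (w (xs s) t * poly (p n t) (xs s))" for s
  have moments: "dintegrable L xs I (\<lambda>y. w y t * y ^ k)" for k :: nat
    using ops by (simp add: is_ops_def)
  have G: "(G f has_sum dint L xs I (\<lambda>y. w y t * (poly f y / (x - y)))) I" for f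
    unfolding G_def
    by (intro has_sum_dint dintegrable_cauchy_kernel moments kernel off_support)
  have H: "(H has_sum (if n = 0 then 1 / leadc p 0 t else 0)) I"
    unfolding H_def dint_poly[symmetric] by (intro has_sum_dint dintegrable_poly moments)
  \<comment> \<open>For \<open>n = 0\<close> this is 0 because \<open>pprev\<close> is 0, so it
    differs from the prescribed value \<open>qprev\<close>; the correction is made in
    \<open>q_prev\<close> below.\<close>
  define Q where "Q = dint L xs I (\<lambda>y. w y t * (poly (pprev p n t) y / (x - y)))"
  have "acoeff p a0 (Suc n) t * G (p (Suc n) t) s =
      (x - b n t) * G (p n t) s + ((-1) * H s + (- acoeff p a0 n t) * G (pprev p n t) s)"
    if "s \<in> I" for s
  proof -
    have nz: "x - xs s \<noteq> 0" using off_support that by auto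
    have "acoeff p a0 (Suc n) t * G (p (Suc n) t) s = gap L (xs s) * (w (xs s) t *
        ((acoeff p a0 (Suc n) t * poly (p (Suc n) t) (xs s)) / (x - xs s)))"
      by (simp add: G_def)
    also have "\<dots> = (x - b n t) * G (p n t) s
        + ((-1) * H s + (- acoeff p a0 n t) * G (pprev p n t) s)"
      unfolding poly_recurrence G_def H_def kernel_identity[OF nz]
      by (simp add: algebra_simps del: times_divide_eq_right times_divide_eq_left)
    finally show ?thesis .
  qed
  then have "((\<lambda>s. acoeff p a0 (Suc n) t * G (p (Suc n) t) s) has_sum
      ((x - b n t) * qfun L xs I w p n t x
        + ((-1) * (if n = 0 then 1 / leadc p 0 t else 0) + (- acoeff p a0 n t) * Q))) I"
    unfolding qfun_def Q_def
    by (subst has_sum_cong, assumption) (intro has_sum_add has_sum_cmult_right G H)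
  moreover have "((\<lambda>s. acoeff p a0 (Suc n) t * G (p (Suc n) t) s) has_sum
      (acoeff p a0 (Suc n) t * qfun L xs I w p (Suc n) t x)) I"
    unfolding qfun_def by (intro has_sum_cmult_right G)
  ultimately have q_Suc: "acoeff p a0 (Suc n) t * qfun L xs I w p (Suc n) t x =
      (x - b n t) * qfun L xs I w p n t x
        + ((-1) * (if n = 0 then 1 / leadc p 0 t else 0) + (- acoeff p a0 n t) * Q)"
    using has_sum_unique by blast
  \<comment> \<open>The boundary term and \<open>Q\<close> are complementary: for
    \<open>n = 0\<close> only the former is present and equals a_0 q_{-1}, while for n > 0 it is
    zero and \<open>Q\<close> is the preceding associated function.\<close>
  have q_prev: "acoeff p a0 n t * qprev L xs I w p a0 n t x
      = (if n = 0 then 1 / leadc p 0 t else 0) + acoeff p a0 n t * Q"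
    using acoeff_nonzero[of 0]
    by (cases n) (simp_all add: Q_def pprev_def qprev_def qfun_def acoeff_def dint_def)
  show ?thesis unfolding q_Suc q_prev by simp
qed

section \<open>Matrix form of the recurrence and the determinant\<close>

lemma mat_eval_Kmat:
  "mat_regular_at (Kmat p a0 b n t) x"
  "mat_eval (Kmat p a0 b n t) x = mscale (1 / acoeff p a0 (Suc n) t)
     (vector [vector [x - b n t, - acoeff p a0 n t], vector [acoeff p a0 (Suc n) t, 0]])"
  unfolding Kmat_def
  by (auto simp: mat_regular_at_def mat_eval_def mscale_def vec_eq_iff forall_2 regular_at_mult
      rat_eval_mult regular_at_uminus)

text \<open>The first row collects the two recurrences, whose second one is divided by the common
  factor \<open>w x t\<close>; the second row is the index shift.\<close>

lemma Ymat_Suc: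
  "Ymat L xs I w p a0 (Suc n) x t = mat_eval (Kmat p a0 b n t) x ** Ymat L xs I w p a0 n x t"
proof -
  have 1: "poly (p (Suc n) t) x = ((x - b n t) * poly (p n t) x
      - acoeff p a0 n t * poly (pprev p n t) x) / acoeff p a0 (Suc n) t"
    using poly_recurrence[of n x] acoeff_nonzero[of "Suc n"] by (simp add: field_simps)
  have 2: "qfun L xs I w p (Suc n) t x = ((x - b n t) * qfun L xs I w p n t x
      - acoeff p a0 n t * qprev L xs I w p a0 n t x) / acoeff p a0 (Suc n) t"
    using q_recurrence[of n] acoeff_nonzero[of "Suc n"] by (simp add: field_simps)
  have 3: "pprev p (Suc n) t = p n t" "qprev L xs I w p a0 (Suc n) t x = qfun L xs I w p n t x"
    by (simp_all add: pprev_def qprev_def)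
  show ?thesis
    unfolding mat_eval_Kmat Ymat_def 1 2 3 using acoeff_nonzero[of "Suc n"] weight
    by (simp add: matrix_2_simps mscale_def field_simps)
qed

text \<open>At index 0 the matrix is upper triangular, since p_{-1} = 0, with determinant 1/(a_0 w).
  Each further step multiplies the determinant by that of the recurrence matrix, a_n/a_{n+1}, which
  is nonzero.\<close>

lemma det_Ymat_nonzero: "det (Ymat L xs I w p a0 n x t) \<noteq> 0"
proof (induction n)
  case 0
  show ?case
    using leadc_nonzero[of 0] weight acoeff_nonzero[of 0]
    by (simp add: Ymat_def det_2 poly_p0 pprev_def qprev_def acoeff_def)
next
  case (Suc n)
  have "det (mat_eval (Kmat p a0 b n t) x) \<noteq> 0"
    using acoeff_nonzero[of "Suc n"] acoeff_nonzero[of n]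
    by (simp add: mat_eval_Kmat det_2 mscale_def)
  with Suc show ?case by (simp add: Ymat_Suc det_mul)
qed

end

section \<open>Compatibility\<close>

theorem proposition6p8:
  fixes L Lu :: lattice and xs :: "int \<Rightarrow> complex" and I :: "int set"
    and X T :: "complex set" and u :: complex
    and w :: "complex \<Rightarrow> complex \<Rightarrow> complex"
    and W V R S :: "complex \<Rightarrow> complex poly"
    and p :: "nat \<Rightarrow> complex \<Rightarrow> complex poly"
    and a0 :: "complex \<Rightarrow> complex" and b :: "nat \<Rightarrow> complex \<Rightarrow> complex"
    and B :: "nat \<Rightarrow> ratfun^2^2"
  assumes "deformed_semi_classical_ops L xs I X Lu T u w W V R S p a0 b"
    and "infinite (X - xs ` I)"
    and "\<And>n. is_deformation_matrix Lu (X - xs ` I) u (Ymat L xs I w p a0 n) (B n)"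
  shows "\<forall>n.
    (let \<Delta>v = rconst (gap Lu u); K = Kmat p a0 b n; MK = MM Lu K u; DK = DD rconst Lu K u;
         Bminus = (\<lambda>m. mat 1 - mscale (\<Delta>v / 2) (B m));
         Bplus = (\<lambda>m. mat 1 + mscale (\<Delta>v / 2) (B m))
     in B (Suc n) ** MK - MK ** B n = DK - mscale (\<Delta>v^2 / 4) (B (Suc n) ** DK ** B n) \<and>
        invertible (Bminus n) \<and> invertible (Bminus (Suc n)) \<and>
        K (iota_plus Lu u) ** matrix_inv (Bminus n) ** Bplus n
          = matrix_inv (Bminus (Suc n)) ** Bplus (Suc n) ** K (iota_minus Lu u))"
proof -

  \<comment> \<open>Factorisations of the shifted matrices outside a finite exceptional set\<close>
  define Z where "Z = X - xs ` I"
  define h where "h = gap Lu u / 2"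
  define A where "A m = mat 1 - mscale (rconst h) (B m)" for m
  define C where "C m = mat 1 + mscale (rconst h) (B m)" for m
  define Y where "Y m = Ymat L xs I w p a0 m" for m
  have gap: "gap Lu u \<noteq> 0" and T: "iota_plus Lu u \<in> T" "iota_minus Lu u \<in> T"
    using assms(1) by (simp_all add: deformed_semi_classical_ops_def)
  have system: "is_ops L xs I w p a0 b t" "dintegrable L xs I (\<lambda>y. w y t * (1 / (x - y)))"
      "x \<notin> xs ` I" "w x t \<noteq> 0" if "t \<in> T" "x \<in> Z" for t x
    using assms(1) that by (auto simp: deformed_semi_classical_ops_def Z_def)
  \<comment> \<open>The defining relation may fail at finitely many points, and at a pole of
    \<open>B m\<close> evaluation yields only the conventional 0; both kinds of points are
    discarded.\<close>
  define good where
    "good m = {x \<in> Z. DD id Lu (Y m x) u = mat_eval (B m) x ** MM Lu (Y m x) u \<and>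
       mat_regular_at (B m) x}" for m
  have bad: "finite (Z - good m)" for m
  proof (rule finite_subset)
    show "Z - good m \<subseteq> {x \<in> Z. DD id Lu (Y m x) u \<noteq> mat_eval (B m) x ** MM Lu (Y m x) u}
        \<union> {x. \<not> mat_regular_at (B m) x}"
      by (auto simp: good_def)
    show "finite \<dots>"
      using assms(3)[of m] finite_not_mat_regular_at
      by (simp add: is_deformation_matrix_def Y_def Z_def)
  qed
  \<comment> \<open>Two indices are treated together because the compatibility argument uses
    \<open>B n\<close> and \<open>B (Suc n)\<close> at the same point.\<close>
  have infinite_good: "infinite (good m \<inter> good k)" for m k
  proof
    assume "finite (good m \<inter> good k)"
    then have "finite ((Z - good m) \<union> (Z - good k) \<union> (good m \<inter> good k))"
      using bad by blast
    then have "finite Z" by (rule rev_finite_subset) blast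
    with assms(2) show False by (simp add: Z_def)
  qed
  have regular: "mat_regular_at (A m) x" "mat_regular_at (C m) x" if "x \<in> good m" for m x
    using that by (simp_all add: A_def C_def good_def mat_regular_at_binary mat_regular_at_mscale)
  have factors: "mat_eval (A m) x ** MM Lu (Y m x) u = Y m x (iota_minus Lu u)"
      "mat_eval (C m) x ** MM Lu (Y m x) u = Y m x (iota_plus Lu u)" if "x \<in> good m" for m x
    using shifted_values_from_mean[of Lu "Y m x" u "mat_eval (B m) x"] that gap
    by (simp_all add: A_def C_def good_def h_def mat_regular_at_binary mat_regular_at_mscale)
  \<comment> \<open>The nonzero determinant of Y at the minus shift is the product of these two
    determinants, so invertibility of the mean is derived together with that of
    \<open>A m\<close>.\<close>
  have det_nonzero: "det (mat_eval (A m) x) \<noteq> 0 \<and> det (MM Lu (Y m x) u) \<noteq> 0"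
    if "x \<in> good m" for m x
  proof -
    have "x \<in> Z" using that by (simp add: good_def)
    from det_Ymat_nonzero[OF system[OF T(2) this]] have "det (Y m x (iota_minus Lu u)) \<noteq> 0"
      by (simp add: Y_def)
    then show ?thesis unfolding factors(1)[OF that, symmetric] by (simp add: det_mul)
  qed
  \<comment> \<open>A nonzero value at a single good point already makes the determinant a nonzero
    rational function. This gives \<open>matrix_inv (A m)\<close> its meaning as a true inverse over
    that field.\<close>
  have invertible_A: "invertible (A m)" for m
  proof -
    from infinite_good[of m m] obtain x where "x \<in> good m"
      by (metis Int_absorb ex_in_conv finite.emptyI)
    then have "rat_eval (det (A m)) x \<noteq> 0"
      using det_nonzero regular by (simp add: det_regular_at)
    then have "det (A m) \<noteq> 0" by auto
    then show ?thesis by (simp add: invertible_det_nz)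
  qed
  show ?thesis
  proof
    fix n

    \<comment> \<open>The identity between rational matrices and its two rearrangements\<close>
    define Kp Km where "Kp = Kmat p a0 b n (iota_plus Lu u)" and "Km = Kmat p a0 b n (iota_minus Lu u)"
    define M D where "M = MM Lu (Kmat p a0 b n) u" and "D = DD rconst Lu (Kmat p a0 b n) u"
    have main: "A (Suc n) ** Kp ** C n = C (Suc n) ** Km ** A n"
    proof (rule ratfun_matrix_eqI[OF infinite_good[of n "Suc n"]])
      fix x assume "x \<in> good n \<inter> good (Suc n)"
      then have x: "x \<in> good n" "x \<in> good (Suc n)" "x \<in> Z" by (auto simp: good_def)
      have K: "mat_regular_at Kp x" "mat_regular_at Km x"
        unfolding Kp_def Km_def
        using mat_eval_Kmat(1)[OF system[OF T(1) x(3)]] mat_eval_Kmat(1)[OF system[OF T(2) x(3)]]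
        by blast+
      note reg = regular[OF x(1)] regular[OF x(2)] K
      have Y_Suc: "Y (Suc n) x (iota_plus Lu u) = mat_eval Kp x ** Y n x (iota_plus Lu u)"
          "Y (Suc n) x (iota_minus Lu u) = mat_eval Km x ** Y n x (iota_minus Lu u)"
        unfolding Kp_def Km_def Y_def
        using Ymat_Suc[OF system[OF T(1) x(3)]] Ymat_Suc[OF system[OF T(2) x(3)]] by blast+
      let ?N = "MM Lu (Y n x) u" and ?N' = "MM Lu (Y (Suc n) x) u"
      \<comment> \<open>The chain passes from the mean at index \<open>n\<close> to the plus shift,
        up to index \<open>Suc n\<close>, and to the mean there; exchanging the two Cayley factors
        switches to the minus shift, along which the chain descends to \<open>n\<close>.\<close>
      have "mat_eval (A (Suc n) ** Kp ** C n) x ** ?N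
          = mat_eval (A (Suc n)) x ** Y (Suc n) x (iota_plus Lu u)"
        by (simp add: reg mat_regular_at_binary Y_Suc factors(2)[OF x(1)] flip: matrix_mul_assoc)
      also have "\<dots> = mat_eval (A (Suc n)) x ** mat_eval (C (Suc n)) x ** ?N'"
        by (simp add: factors(2)[OF x(2)] flip: matrix_mul_assoc)
      also have "mat_eval (A (Suc n)) x ** mat_eval (C (Suc n)) x
          = mat_eval (C (Suc n)) x ** mat_eval (A (Suc n)) x"
        using cayley_factors_commute[of "rconst h" "B (Suc n)"] reg
        by (simp add: mat_regular_at_binary(6)[symmetric] flip: A_def C_def)
      also have "\<dots> ** ?N' = mat_eval (C (Suc n)) x ** Y (Suc n) x (iota_minus Lu u)"
        by (simp add: factors(1)[OF x(2)] flip: matrix_mul_assoc)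
      also have "\<dots> = mat_eval (C (Suc n) ** Km ** A n) x ** ?N"
        by (simp add: reg mat_regular_at_binary Y_Suc factors(1)[OF x(1)] flip: matrix_mul_assoc)
      finally have eq: "mat_eval (A (Suc n) ** Kp ** C n) x ** ?N
          = mat_eval (C (Suc n) ** Km ** A n) x ** ?N" .
      have N: "invertible ?N" using det_nonzero[OF x(1)] by (simp add: invertible_det_nz)
      have "mat_eval (A (Suc n) ** Kp ** C n) x = mat_eval (C (Suc n) ** Km ** A n) x"
        using arg_cong[OF eq, of "\<lambda>P. P ** matrix_inv ?N"] N
        by (simp add: matrix_inv_mult flip: matrix_mul_assoc)
      then show "mat_regular_at (A (Suc n) ** Kp ** C n) x \<and>
          mat_regular_at (C (Suc n) ** Km ** A n) x \<and>
          mat_eval (A (Suc n) ** Kp ** C n) x = mat_eval (C (Suc n) ** Km ** A n) x"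
        by (simp add: reg mat_regular_at_binary)
    qed
    \<comment> \<open>Characteristic 0 is inherited from the complex numbers through the embedding
      \<open>rconst\<close>; it is needed to divide by 2 and 4.\<close>
    have two: "(2::ratfun) \<noteq> 0" using rconst_eq_0_iff[of 2] by (simp add: rconst_2)
    moreover have "(4::ratfun) = 2 * 2" by simp
    ultimately have four: "(4::ratfun) \<noteq> 0" by (metis mult_eq_0_iff)
    have g: "rconst (gap Lu u) = 2 * rconst h" "rconst h \<noteq> 0"
      using gap two by (simp_all add: h_def rconst_half)
    \<comment> \<open>Mean and divided difference again recover the shifted values, now for matrices
      over the field of rational functions.\<close>
    have "(M + mscale (rconst h) D) $ i $ j = Kp $ i $ j"
      "(M - mscale (rconst h) D) $ i $ j = Km $ i $ j" for i j
      using g two four by (simp_all add: M_def D_def MM_def DD_def Kp_def Km_def mscale_def field_simps)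
    then have KMD: "Kp = M + mscale (rconst h) D" "Km = M - mscale (rconst h) D"
      by (simp_all add: vec_eq_iff)
    have "B (Suc n) ** M - M ** B n = D - mscale (rconst h ^ 2) (B (Suc n) ** D ** B n)"
      using main unfolding KMD A_def C_def using cayley_compatibility_iff[OF g(2) two] by blast
    \<comment> \<open>The factor 1/4 of the compatibility relation is the square of the 1/2 in
      \<open>h\<close>.\<close>
    moreover have "rconst h ^ 2 = rconst (gap Lu u) ^ 2 / 4"
      using four by (simp add: g(1) power2_eq_square)
    \<comment> \<open>The product form comes from the same identity \<open>main\<close>, by moving
      the two factors \<open>A\<close> to the opposite sides as inverses.\<close>
    moreover have "Kp ** matrix_inv (A n) ** C n = matrix_inv (A (Suc n)) ** C (Suc n) ** Km"
      using invertible_A main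
      by (intro conjugate_by_inverses) (simp_all add: A_def C_def cayley_factors_commute)
    moreover have "A m = mat 1 - mscale (rconst (gap Lu u) / 2) (B m)"
      and "C m = mat 1 + mscale (rconst (gap Lu u) / 2) (B m)" for m
      by (simp_all add: A_def C_def h_def rconst_half)
    ultimately show "let \<Delta>v = rconst (gap Lu u); K = Kmat p a0 b n; MK = MM Lu K u;
         DK = DD rconst Lu K u;
         Bminus = (\<lambda>m. mat 1 - mscale (\<Delta>v / 2) (B m));
         Bplus = (\<lambda>m. mat 1 + mscale (\<Delta>v / 2) (B m))
     in B (Suc n) ** MK - MK ** B n = DK - mscale (\<Delta>v^2 / 4) (B (Suc n) ** DK ** B n) \<and>
        invertible (Bminus n) \<and> invertible (Bminus (Suc n)) \<and>
        K (iota_plus Lu u) ** matrix_inv (Bminus n) ** Bplus n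
          = matrix_inv (Bminus (Suc n)) ** Bplus (Suc n) ** K (iota_minus Lu u)"
      using invertible_A unfolding Let_def Kp_def Km_def M_def D_def by metis
  qed
qed

end
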